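(* Let $D=(V,A)$ be an acyclic digraph and let $F\subseteq V$. Then every convex set of $D$ containing $F$ is output exactly once by the procedure $\mathrm{CS}(D,F)$ (described in the context).
   Context: A set $X$ of vertices of an acyclic digraph $D$ is convex if $X\neq\emptyset$ and there is no directed path between two vertices of $X$ containing a vertex not in $X$. A vertex is a source (sink) if it has no in-neighbours (out-neighbours). For a vertex $s$, $D-s$ is the digraph obtained by deleting $s$. Procedure $\mathrm{CS}(D=(V,A),F)$: (1) output $V$; (2) for each vertex $s\in V\setminus F$ that is a source or sink of $D$, in turn: call $\mathrm{CS}(D-s,F)$, and then set $F:=F\cup\{s\}$ (so later recursive calls in this loop use the enlarged $F$). *)

theory Defs
  imports "Graph_Theory.Graph_Theory"
begin

definition acyclic_digraph :: "('a, 'b) pre_digraph \<Rightarrow> bool" where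
  "acyclic_digraph D \<longleftrightarrow> digraph D \<and> (\<nexists>p. pre_digraph.cycle D p)"

definition convex_set :: "('a, 'b) pre_digraph \<Rightarrow> 'a set \<Rightarrow> bool" where
  "convex_set D X \<longleftrightarrow> X \<subseteq> verts D \<and> X \<noteq> {} \<and>
     \<not> (\<exists>u\<in>X. \<exists>v\<in>X. \<exists>p. pre_digraph.apath D u p v \<and>
          (\<exists>w\<in>set (pre_digraph.awalk_verts D u p). w \<notin> X))"

definition is_source :: "('a, 'b) pre_digraph \<Rightarrow> 'a \<Rightarrow> bool" where
  "is_source D s \<longleftrightarrow> s \<in> verts D \<and> (\<nexists>u. u \<rightarrow>\<^bsub>D\<^esub> s)"

definition is_sink :: "('a, 'b) pre_digraph \<Rightarrow> 'a \<Rightarrow> bool" where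
  "is_sink D s \<longleftrightarrow> s \<in> verts D \<and> (\<nexists>u. s \<rightarrow>\<^bsub>D\<^esub> u)"

text \<open>
  The procedure does not prescribe the order in which its loop visits the sources and sinks, so
  it is modelled as a big-step relation: \<open>CS D F out\<close> says that \<open>out\<close> is the list of all
  sets output, in order and with repetitions, by some complete execution of the call on
  \<open>(D, F)\<close>. Each call may visit its vertices in any order \<open>ss\<close>.
  \<open>CS_loop D F ss out\<close> describes executing the loop for the remaining vertices
  \<open>ss\<close>, where \<open>F\<close> is the current value of the program variable.
\<close>

inductive CS :: "('a, 'b) pre_digraph \<Rightarrow> 'a set \<Rightarrow> 'a set list \<Rightarrow> bool"
  and CS_loop :: "('a, 'b) pre_digraph \<Rightarrow> 'a set \<Rightarrow> 'a list \<Rightarrow> 'a set list \<Rightarrow> bool"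
where
  call: "\<lbrakk>distinct ss; set ss = {s \<in> verts D - F. is_source D s \<or> is_sink D s};
          CS_loop D F ss out\<rbrakk> \<Longrightarrow> CS D F (verts D # out)"
| loop_done: "CS_loop D F [] []"
| loop_step: "\<lbrakk>CS (pre_digraph.del_vert D s) F out1; CS_loop D (F \<union> {s}) ss out2\<rbrakk>
          \<Longrightarrow> CS_loop D F (s # ss) (out1 @ out2)"

end

theory Submission
  imports Defs
begin

text \<open>
  Every set output by a call \<open>CS D F\<close> lies between \<open>F\<close> and the vertex set of \<open>D\<close>. Hence when the
  loop processes \<open>s\<close>, the recursive call on \<open>D - s\<close> outputs only sets avoiding \<open>s\<close>, while all later
  iterations output only sets containing \<open>s\<close>; so a convex set \<open>X\<close> is produced exactly in the
  iteration of the first processed \<open>s\<close> outside \<open>X\<close>. Such an \<open>s\<close> exists for every convex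
  \<open>X\<close> other than the whole vertex set: if \<open>w\<close> is a vertex outside \<open>X\<close>, pick a source from which \<open>w\<close>
  is reachable and a sink reachable from \<open>w\<close>; they cannot both lie in \<open>X\<close>, since joining the
  paths through \<open>w\<close> would violate convexity.
\<close>

text \<open>A nonempty closed walk contains a cycle. This turns the absence of cycles into
  acyclicity of a finite relation, which is therefore well-founded in both directions.\<close>

lemma acyclic_arcs_ends:
  assumes "acyclic_digraph D"
  shows "acyclic (arcs_ends D)"
proof (rule acyclicI, intro allI notI)
  interpret digraph D using assms by (simp add: acyclic_digraph_def)
  fix x assume "(x, x) \<in> (arcs_ends D)\<^sup>+"
  then obtain p where "awalk x p x" "p \<noteq> []" by (auto simp: reachable1_awalk)
  then have "closed_w p" by (auto simp: closed_w_def)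
  then show False using closed_w_imp_cycle assms by (auto simp: acyclic_digraph_def)
qed

text \<open>A repeated vertex would cut a closed walk out of \<open>p\<close>. Convexity speaks of
  paths whereas reachability supplies walks; this bridges the two.\<close>

lemma awalk_imp_apath:
  assumes "acyclic_digraph D" and "pre_digraph.awalk D u p v"
  shows "pre_digraph.apath D u p v"
proof -
  interpret digraph D using assms(1) by (simp add: acyclic_digraph_def)
  have "distinct (awalk_verts u p)"
  proof (rule ccontr)
    assume "\<not> distinct (awalk_verts u p)"
    then obtain r where "closed_w r" using awalk_cyc_decompE'[OF assms(2)] by metis
    then show False using closed_w_imp_cycle assms(1) by (auto simp: acyclic_digraph_def)
  qed
  then show ?thesis using assms(2) by (simp add: apath_def)
qed

lemma obtain_source_reaching:
  assumes "acyclic_digraph D" and "w \<in> verts D"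
  obtains s where "is_source D s" and "s \<rightarrow>\<^sup>*\<^bsub>D\<^esub> w"
proof -
  interpret digraph D using assms(1) by (simp add: acyclic_digraph_def)
  have "wf (arcs_ends D)"
    using acyclic_arcs_ends[OF assms(1)] by (intro finite_acyclic_wf) (auto simp: arcs_ends_def)
  \<comment> \<open>A minimal element of this set is a source, because any in-neighbour of it would
    also reach \<open>w\<close>.\<close>
  moreover have "w \<in> {x. x \<rightarrow>\<^sup>*\<^bsub>D\<^esub> w}" using assms(2) by simp
  ultimately obtain s where s: "s \<rightarrow>\<^sup>*\<^bsub>D\<^esub> w" "\<And>u. u \<rightarrow>\<^bsub>D\<^esub> s \<Longrightarrow> \<not> u \<rightarrow>\<^sup>*\<^bsub>D\<^esub> w"
    by (metis (mono_tags, lifting) mem_Collect_eq wfE_min)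
  then have "is_source D s"
    by (auto simp: is_source_def dest: reachable_in_verts adj_reachable_trans)
  with s(1) show thesis by (rule that[rotated])
qed

lemma obtain_sink_reachable:
  assumes "acyclic_digraph D" and "w \<in> verts D"
  obtains t where "is_sink D t" and "w \<rightarrow>\<^sup>*\<^bsub>D\<^esub> t"
proof -
  interpret digraph D using assms(1) by (simp add: acyclic_digraph_def)
  have "wf ((arcs_ends D)\<inverse>)"
    using acyclic_arcs_ends[OF assms(1)]
    by (intro finite_acyclic_wf_converse) (auto simp: arcs_ends_def)
  moreover have "w \<in> {x. w \<rightarrow>\<^sup>*\<^bsub>D\<^esub> x}" using assms(2) by simp
  ultimately obtain t where t: "w \<rightarrow>\<^sup>*\<^bsub>D\<^esub> t" "\<And>u. t \<rightarrow>\<^bsub>D\<^esub> u \<Longrightarrow> \<not> w \<rightarrow>\<^sup>*\<^bsub>D\<^esub> u"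
    by (metis (mono_tags, lifting) converse_iff mem_Collect_eq wfE_min)
  then have "is_sink D t"
    by (auto simp: is_sink_def dest: reachable_in_verts reachable_adj_trans)
  with t(1) show thesis by (rule that[rotated])
qed

lemma convex_set_reachable_between:
  assumes "acyclic_digraph D" and "convex_set D X" and "u \<in> X" and "v \<in> X"
    and "u \<rightarrow>\<^sup>*\<^bsub>D\<^esub> w" and "w \<rightarrow>\<^sup>*\<^bsub>D\<^esub> v"
  shows "w \<in> X"
proof -
  interpret digraph D using assms(1) by (simp add: acyclic_digraph_def)
  obtain p q where pq: "awalk u p w" "awalk w q v"
    using assms(5,6) by (auto simp: reachable_awalk)
  then have "apath u (p @ q) v" by (intro awalk_imp_apath assms(1) awalk_appendI)
  moreover have "w \<in> set (awalk_verts u (p @ q))"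
    using set_awalk_verts_append[OF pq] pq(2) by (auto simp: set_awalk_verts)
  ultimately show ?thesis using assms(2-4) unfolding convex_set_def by blast
qed

lemma convex_set_misses_source_or_sink:
  assumes "acyclic_digraph D" and "convex_set D X" and "X \<noteq> verts D"
  obtains s where "s \<in> verts D" and "s \<notin> X" and "is_source D s \<or> is_sink D s"
proof -
  obtain w where w: "w \<in> verts D" "w \<notin> X" using assms(2,3) by (auto simp: convex_set_def)
  obtain s t where st: "is_source D s" "s \<rightarrow>\<^sup>*\<^bsub>D\<^esub> w" "is_sink D t" "w \<rightarrow>\<^sup>*\<^bsub>D\<^esub> t"
    using obtain_source_reaching[OF assms(1) w(1)] obtain_sink_reachable[OF assms(1) w(1)] by metis
  then have "s \<notin> X \<or> t \<notin> X" using convex_set_reachable_between[OF assms(1,2)] w(2) by blast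
  then show thesis using that st(1,3) by (auto simp: is_source_def is_sink_def)
qed

lemma acyclic_digraph_del_vert:
  assumes "acyclic_digraph D"
  shows "acyclic_digraph (pre_digraph.del_vert D s)"
proof -
  interpret digraph D using assms by (simp add: acyclic_digraph_def)
  have "digraph (del_vert s)"
    by standard (auto simp: del_vert_simps arc_to_ends_def no_loops intro: no_multi_arcs)
  then show ?thesis
    using assms subgraph_cycle[OF subgraph_del_vert] by (auto simp: acyclic_digraph_def)
qed

lemma convex_set_del_vert:
  assumes "acyclic_digraph D" and "convex_set D X" and "s \<notin> X"
  shows "convex_set (pre_digraph.del_vert D s) X"
proof -
  interpret digraph D using assms(1) by (simp add: acyclic_digraph_def)
  have "pre_digraph.awalk_verts (del_vert s) u p = awalk_verts u p" for u p
    \<comment> \<open>\<open>awalk_verts\<close> depends only on the tail and head functions, which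
      vertex deletion keeps.\<close>
    by (metis compatible_awalk_verts subgraph_del_vert subgraph_def)
  moreover have "apath u p v" if "pre_digraph.apath (del_vert s) u p v" for u p v
    using that subgraph_del_vert by (rule subgraph_apath_imp_apath)
  moreover have "X \<subseteq> verts (del_vert s)"
    using assms(2,3) by (auto simp: convex_set_def verts_del_vert)
  ultimately show ?thesis using assms(2) unfolding convex_set_def by metis
qed

text \<open>Recursive calls lose a vertex, so every execution order can be completed. This keeps the
  claim about all executions from being vacuous.\<close>

lemma CS_exists:
  assumes "finite (verts D)"
  shows "\<exists>out. CS D F out"
  using assms
proof (induction "card (verts D)" arbitrary: D F rule: less_induct)
  case less
  \<comment> \<open>The set is generalized to \<open>F'\<close> because it grows during the
    loop.\<close>
  have loop: "\<exists>out. CS_loop D F' ss out" if "set ss \<subseteq> verts D" for F' ss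
    using that
  proof (induction ss arbitrary: F')
    case Nil
    show ?case using loop_done by blast
  next
    case (Cons s ss)
    have "card (verts (pre_digraph.del_vert D s)) < card (verts D)"
      unfolding pre_digraph.verts_del_vert
      using Cons.prems less.prems by (intro card_Diff1_less) auto
    then obtain out1 where "CS (pre_digraph.del_vert D s) F' out1"
      using less by (metis finite_Diff pre_digraph.verts_del_vert)
    moreover obtain out2 where "CS_loop D (F' \<union> {s}) ss out2"
      using Cons by (metis set_subset_Cons subset_trans)
    ultimately have "CS_loop D F' (s # ss) (out1 @ out2)" by (rule loop_step)
    then show ?case ..
  qed
  obtain ss where "distinct ss" "set ss = {s \<in> verts D - F. is_source D s \<or> is_sink D s}"
    using less.prems finite_distinct_list[of "{s \<in> verts D - F. is_source D s \<or> is_sink D s}"]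
    by auto
  moreover from this obtain out where "CS_loop D F ss out" using loop[of ss F] by auto
  ultimately have "CS D F (verts D # out)" by (rule call)
  then show ?case ..
qed

text \<open>The loop invariant is that the pending vertices are distinct and lie outside the current
  \<open>F\<close>. Hence deleting \<open>s\<close> leaves \<open>F\<close> intact, and adding
  \<open>s\<close> to \<open>F\<close> preserves the invariant.\<close>

lemma CS_output_bounds:
  shows "CS D F out \<Longrightarrow> F \<subseteq> verts D \<Longrightarrow> Y \<in> set out \<Longrightarrow> F \<subseteq> Y \<and> Y \<subseteq> verts D"
    and "CS_loop D F ss out \<Longrightarrow> distinct ss \<Longrightarrow> F \<inter> set ss = {} \<Longrightarrow> set ss \<subseteq> verts D \<Longrightarrow>
      F \<subseteq> verts D \<Longrightarrow> Y \<in> set out \<Longrightarrow> F \<subseteq> Y \<and> Y \<subseteq> verts D"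
proof (induction rule: CS_CS_loop.inducts)
  case (call ss D F out)
  then show ?case by fastforce
next
  case (loop_done D F)
  then show ?case by simp
next
  case (loop_step D s F out1 ss out2)
  have "F \<subseteq> verts (pre_digraph.del_vert D s)" "F \<union> {s} \<subseteq> verts D"
       "(F \<union> {s}) \<inter> set ss = {}"
    using loop_step.prems by (auto simp: pre_digraph.verts_del_vert)
  then show ?case using loop_step by (auto simp: pre_digraph.verts_del_vert)
qed

lemma count_list_CS:
  shows "CS D F out \<Longrightarrow> acyclic_digraph D \<Longrightarrow> F \<subseteq> verts D \<Longrightarrow> convex_set D X \<Longrightarrow> F \<subseteq> X \<Longrightarrow>
      count_list out X = 1"
    and "CS_loop D F ss out \<Longrightarrow> acyclic_digraph D \<Longrightarrow> distinct ss \<Longrightarrow> F \<inter> set ss = {} \<Longrightarrow>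
      set ss \<subseteq> verts D \<Longrightarrow> F \<subseteq> verts D \<Longrightarrow> convex_set D X \<Longrightarrow> F \<subseteq> X \<Longrightarrow>
      count_list out X = (if set ss \<subseteq> X then 0 else 1)"
proof (induction rule: CS_CS_loop.inducts)
  case (call ss D F out)
  have "F \<inter> set ss = {}" "set ss \<subseteq> verts D" using call.hyps(2) by auto
  then have "count_list out X = (if set ss \<subseteq> X then 0 else 1)"
    using call.IH call.hyps(1) call.prems by blast
  \<comment> \<open>So the initial output \<open>verts D\<close> equals \<open>X\<close> exactly
    when the loop contributes 0.\<close>
  moreover have "set ss \<subseteq> X \<longleftrightarrow> X = verts D"
  proof
    assume "set ss \<subseteq> X"
    show "X = verts D"
    proof (rule ccontr)
      assume "X \<noteq> verts D"
      then obtain s where "s \<in> verts D" "s \<notin> X" "is_source D s \<or> is_sink D s"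
        by (rule convex_set_misses_source_or_sink[OF call.prems(1,3)])
      \<comment> \<open>Since \<open>F\<close> is contained in \<open>X\<close>, the vertex
        \<open>s\<close> is outside \<open>F\<close> and thus occurs in \<open>ss\<close>.\<close>
      then show False using \<open>set ss \<subseteq> X\<close> call.hyps(2) call.prems(4) by auto
    qed
  qed (use call.hyps(2) in auto)
  ultimately show ?case by auto
next
  case (loop_done D F)
  then show ?case by simp
next
  case (loop_step D s F out1 ss out2)
  have F: "F \<subseteq> verts (pre_digraph.del_vert D s)" "F \<union> {s} \<subseteq> verts D"
       "(F \<union> {s}) \<inter> set ss = {}" and ss: "distinct ss" "set ss \<subseteq> verts D"
    using loop_step.prems by (auto simp: pre_digraph.verts_del_vert)
  show ?case
  proof (cases "s \<in> X")
    case True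
    have "X \<notin> set out1"
      using CS_output_bounds(1)[OF loop_step.hyps(1) F(1)] True
      by (auto simp: pre_digraph.verts_del_vert)
    \<comment> \<open>The enlarged set \<open>F \<union> {s}\<close> is still contained in
      \<open>X\<close>, so the induction hypothesis applies.\<close>
    moreover have "count_list out2 X = (if set ss \<subseteq> X then 0 else 1)"
      using loop_step.IH(2) loop_step.prems F ss True by auto
    ultimately show ?thesis using True by (simp add: count_list_0_iff)
  next
    case False
    have "count_list out1 X = 1"
      using loop_step.prems F(1) False
      by (intro loop_step.IH(1) acyclic_digraph_del_vert convex_set_del_vert)
    moreover have "X \<notin> set out2"
      using CS_output_bounds(2)[OF loop_step.hyps(2) ss(1) F(3) ss(2) F(2)] False by auto
    ultimately show ?thesis using False by (simp add: count_list_0_iff)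
  qed
qed

theorem theorem11:
  fixes D :: "('a, 'b) pre_digraph" and F :: "'a set"
  assumes "acyclic_digraph D" and "F \<subseteq> verts D"
  shows "(\<exists>out. CS D F out) \<and>
         (\<forall>out. CS D F out \<longrightarrow>
            (\<forall>X. convex_set D X \<and> F \<subseteq> X \<longrightarrow> count_list out X = 1))"
proof -
  interpret digraph D using assms(1) by (simp add: acyclic_digraph_def)
  show ?thesis using CS_exists[OF finite_verts] count_list_CS(1) assms by blast
qed

end
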